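(* Let $D$ be any number and put $A=D-2$, $B=-3D+6$, $C=-D+3$. Then for every integer $n\ge 0$, \begin{align*} \sum_{\substack{k_1+k_2+k_3=n\\ k_1,k_2,k_3\ge 1}}\binom{n}{k_1,k_2,k_3}T_{k_1}T_{k_2}T_{k_3} &=\frac{A}{44}3^nT_{n}^{(3,3,5)}+\frac{B}{44}+\frac{C}{22}\sum_{k=0}^n\binom{n}{k}2^{n-k}T_{n-k}^{(2,3,10)}T_k\\ &\quad+\frac{D}{22}\sum_{\substack{k_1+k_2+k_3=n\\ k_1,k_2,k_3\ge0}}\binom{n}{k_1,k_2,k_3}(-1)^{k_1}T_{k_1}^{(-1,2,7)}T_{k_2}. \end{align*}
   Context: The Tribonacci numbers are $T_n=T_n^{(0,1,1)}$, where for numbers $s_0,s_1,s_2$ the sequence $T_n^{(s_0,s_1,s_2)}$ is defined by $T_0^{(s_0,s_1,s_2)}=s_0$, $T_1^{(s_0,s_1,s_2)}=s_1$, $T_2^{(s_0,s_1,s_2)}=s_2$ and $T_n^{(s_0,s_1,s_2)}=T_{n-1}^{(s_0,s_1,s_2)}+T_{n-2}^{(s_0,s_1,s_2)}+T_{n-3}^{(s_0,s_1,s_2)}$ for $n\ge3$. $\binom{n}{k_1,\dots,k_r}=\frac{n!}{k_1!\cdots k_r!}$ denotes the multinomial coefficient. *)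

theory Defs
  imports Complex_Main
begin

fun gen_tribonacci :: "'a::plus \<Rightarrow> 'a \<Rightarrow> 'a \<Rightarrow> nat \<Rightarrow> 'a" where
  "gen_tribonacci s0 s1 s2 0 = s0"
| "gen_tribonacci s0 s1 s2 (Suc 0) = s1"
| "gen_tribonacci s0 s1 s2 (Suc (Suc 0)) = s2"
| "gen_tribonacci s0 s1 s2 (Suc (Suc (Suc n))) =
     gen_tribonacci s0 s1 s2 (Suc (Suc n)) + gen_tribonacci s0 s1 s2 (Suc n)
       + gen_tribonacci s0 s1 s2 n"

definition tribonacci :: "nat \<Rightarrow> 'a::semiring_1" where
  "tribonacci = gen_tribonacci 0 1 1"

definition multinomial3 :: "nat \<Rightarrow> nat \<Rightarrow> nat \<Rightarrow> nat \<Rightarrow> 'a::field_char_0" where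
  "multinomial3 n k1 k2 k3 = fact n / (fact k1 * fact k2 * fact k3)"

end

theory Submission
  imports Defs "HOL-Computational_Algebra.Computational_Algebra"
begin

text \<open>
  Let \<open>a, b, c\<close> be the roots of \<open>x\<^sup>3 = x\<^sup>2 + x + 1\<close>. The exponential generating function of
  the Tribonacci numbers is \<open>F = X + Y + Z\<close> with \<open>X = u e\<^sup>a\<^sup>x\<close>, \<open>Y = v e\<^sup>b\<^sup>x\<close>, \<open>Z = w e\<^sup>c\<^sup>x\<close>.
  The four terms on the right-hand side are, up to the coefficients \<open>A, B, C, D\<close>, the power sum
  \<open>X\<^sup>3 + Y\<^sup>3 + Z\<^sup>3\<close>, the product \<open>X Y Z\<close> (where \<open>a + b + c = 1\<close> gives \<open>e\<^sup>x\<close>),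
  \<open>(X\<^sup>2 + Y\<^sup>2 + Z\<^sup>2) F\<close>, and \<open>(X Y + Y Z + Z X) F\<close> (where \<open>e\<^sup>(\<^sup>a\<^sup>+\<^sup>b\<^sup>)\<^sup>x = e\<^sup>x e\<^sup>-\<^sup>c\<^sup>x\<close>).
  The condition on \<open>A, B, C, D\<close> makes this combination equal to \<open>(X + Y + Z)\<^sup>3\<close>.
\<close>

definition egf :: "(nat \<Rightarrow> 'a::field_char_0) \<Rightarrow> 'a fps" where
  "egf f = Abs_fps (\<lambda>n. f n / fact n)"

lemma egf_nth [simp]: "egf f $ n = f n / fact n"
  by (simp add: egf_def)

lemma finite_triples_sum: "finite {(k1, k2, k3). k1 + k2 + k3 = (n::nat)}"
  by (rule finite_subset[of _ "{..n} \<times> {..n} \<times> {..n}"]) auto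

text \<open>\<open>multinomial3\<close> is \<open>fact n\<close> over the factorials that
  \<open>egf\<close> divides by. Since \<open>k3 = n - k1 - k2\<close>, the triples form the index
  set of two nested Cauchy products.\<close>

lemma sum_multinomial3_eq_egf:
  fixes f g h :: "nat \<Rightarrow> 'a::field_char_0"
  shows "(\<Sum>(k1, k2, k3) \<in> {(k1, k2, k3). k1 + k2 + k3 = n}.
            multinomial3 n k1 k2 k3 * f k1 * g k2 * h k3)
         = fact n * (egf f * egf g * egf h) $ n"
proof -
  have "(\<Sum>(k1, k2, k3) \<in> {(k1, k2, k3). k1 + k2 + k3 = n}.
            multinomial3 n k1 k2 k3 * f k1 * g k2 * h k3)
      = (\<Sum>(i, j) \<in> Sigma {0..n} (\<lambda>i. {0..n - i}).
            multinomial3 n i j (n - i - j) * f i * g j * h (n - i - j))"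
    by (rule sum.reindex_bij_witness[of _ "\<lambda>(i, j). (i, j, n - i - j)" "\<lambda>(i, j, k). (i, j)"]) auto
  also have "\<dots> = (\<Sum>i = 0..n. \<Sum>j = 0..n - i.
            multinomial3 n i j (n - i - j) * f i * g j * h (n - i - j))"
    by (rule sum.Sigma[symmetric]) auto
  also have "\<dots> = fact n * (egf f * (egf g * egf h)) $ n"
    by (simp add: fps_mult_nth sum_distrib_left multinomial3_def mult_ac)
  finally show ?thesis
    by (simp add: mult.assoc)
qed

lemma sum_binomial_eq_egf:
  fixes f g :: "nat \<Rightarrow> 'a::field_char_0"
  shows "(\<Sum>k = 0..n. of_nat (n choose k) * f (n - k) * g k) = fact n * (egf f * egf g) $ n"
  \<comment> \<open>Swapping the factors makes the Cauchy product put \<open>n - k\<close> on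
    \<open>f\<close>, as in the sum.\<close>
  unfolding mult.commute[of "egf f"] fps_mult_nth sum_distrib_left
  by (intro sum.cong) (auto simp: binomial_fact)

text \<open>Both sides obey the same recurrence and agree at 0, 1, 2. The coefficients are given and
  only checked, so no linear system is solved.\<close>

lemma gen_tribonacci_binet:
  fixes a b c :: "'a::comm_ring_1"
  assumes "a ^ 3 = a ^ 2 + a + 1" "b ^ 3 = b ^ 2 + b + 1" "c ^ 3 = c ^ 2 + c + 1"
    and "s0 = u + v + w" "s1 = u * a + v * b + w * c" "s2 = u * a ^ 2 + v * b ^ 2 + w * c ^ 2"
  shows "gen_tribonacci s0 s1 s2 n = u * a ^ n + v * b ^ n + w * c ^ n"
proof (induction n rule: less_induct)
  case (less n)
  have rec: "x ^ Suc (Suc (Suc m)) = x ^ Suc (Suc m) + x ^ Suc m + x ^ m"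
    if "x ^ 3 = x ^ 2 + x + 1" for x :: 'a and m
  proof -
    have "x ^ Suc (Suc (Suc m)) = x ^ m * x ^ 3"
      by (simp add: power3_eq_cube mult_ac)
    then show ?thesis
      by (simp add: that algebra_simps power2_eq_square)
  qed
  consider "n = 0" | "n = Suc 0" | "n = Suc (Suc 0)" | m where "n = Suc (Suc (Suc m))"
    by (metis not0_implies_Suc)
  then show ?case
  proof cases
    case (4 m)
    then have IH: "gen_tribonacci s0 s1 s2 k = u * a ^ k + v * b ^ k + w * c ^ k"
      if "k \<in> {m, Suc m, Suc (Suc m)}" for k
      using less[of k] that by auto
    show ?thesis
      unfolding 4 gen_tribonacci.simps rec[OF assms(1)] rec[OF assms(2)] rec[OF assms(3)]
      by (simp add: IH algebra_simps del: power_Suc)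
  qed (simp_all add: assms(4-6) power2_eq_square)
qed

text \<open>One root \<open>a\<close> comes from the fundamental theorem of algebra;
  \<open>b\<close> and \<open>c\<close> come from the quadratic formula for the cofactor
  \<open>x\<^sup>2 - (1 - a) x + (a\<^sup>2 - a - 1)\<close>. Vieta's relations are all that is used
  later.\<close>

lemma tribonacci_roots_exist:
  obtains a b c :: complex
  where "a + b + c = 1" "a * b + b * c + c * a = - 1" "a * b * c = 1"
proof -
  have "\<not> constant (poly [:-1, -1, -1, 1 :: complex:])"
    by (simp add: constant_degree)
  then obtain a where a: "poly [:-1, -1, -1, 1 :: complex:] a = 0"
    using fundamental_theorem_of_algebra by blast
  define d where "d = csqrt ((1 - a)\<^sup>2 - 4 * (a\<^sup>2 - a - 1))"
  have d: "d\<^sup>2 = (1 - a)\<^sup>2 - 4 * (a\<^sup>2 - a - 1)"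
    by (simp add: d_def)
  define b c where "b = (1 - a + d) / 2" and "c = (1 - a - d) / 2"
  have sum: "b + c = 1 - a"
    by (simp add: b_def c_def field_simps)
  have "4 * (b * c) = (1 - a)\<^sup>2 - d\<^sup>2"
    by (simp add: b_def c_def field_simps power2_eq_square)
  then have "4 * (b * c) = 4 * (a\<^sup>2 - a - 1)"
    by (simp add: d)
  then have prod: "b * c = a\<^sup>2 - a - 1"
    by (simp only: mult_cancel_left) simp
  show thesis
  proof (rule that)
    show "a + b + c = 1"
      using sum by (simp add: algebra_simps)
    show "a * b + b * c + c * a = - 1"
      using sum prod by algebra
    show "a * b * c = 1"
    proof -
      have "a ^ 3 = a\<^sup>2 + a + 1"
        using a by (simp add: algebra_simps power2_eq_square power3_eq_cube)
      then show ?thesis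
        using prod by algebra
    qed
  qed
qed

theorem theorem2:
  fixes A B C D :: complex and n :: nat
  assumes "A = D - 2" and "B = - 3 * D + 6" and "C = - D + 3"
  shows "(\<Sum>(k1, k2, k3) \<in> {(k1, k2, k3). k1 + k2 + k3 = n \<and> k1 \<ge> 1 \<and> k2 \<ge> 1 \<and> k3 \<ge> 1}.
            multinomial3 n k1 k2 k3 * tribonacci k1 * tribonacci k2 * tribonacci k3)
       = A / 44 * 3 ^ n * gen_tribonacci 3 3 5 n + B / 44
         + C / 22 * (\<Sum>k = 0..n. of_nat (n choose k) * 2 ^ (n - k)
                       * gen_tribonacci 2 3 10 (n - k) * tribonacci k)
         + D / 22 * (\<Sum>(k1, k2, k3) \<in> {(k1, k2, k3). k1 + k2 + k3 = n}.
                       multinomial3 n k1 k2 k3 * (- 1) ^ k1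
                         * gen_tribonacci (- 1) 2 7 k1 * tribonacci k2)"
proof -
  obtain a b c :: complex
    where e1: "a + b + c = 1" and e2: "a * b + b * c + c * a = - 1" and e3: "a * b * c = 1"
    by (rule tribonacci_roots_exist)
  have a: "a ^ 3 = a ^ 2 + a + 1" and b: "b ^ 3 = b ^ 2 + b + 1" and c: "c ^ 3 = c ^ 2 + c + 1"
    using e1 e2 e3 by algebra+
  \<comment> \<open>Binet coefficients will be quadratic in the root, so initial values up to index
    2 need power sums up to the fourth.\<close>
  have p2: "a ^ 2 + b ^ 2 + c ^ 2 = 3"
    using e1 e2 by algebra
  have p3: "a ^ 3 + b ^ 3 + c ^ 3 = 7"
    using a b c e1 p2 by algebra
  have p4: "a ^ 4 + b ^ 4 + c ^ 4 = 11"
    using a b c e1 p2 p3 by algebra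

  \<comment> \<open>The Binet coefficient \<open>a / (3 a\<^sup>2 - 2 a - 1)\<close> and its analogues, written as polynomials in
    the root, so that no division by differences of roots is needed.\<close>
  define u v w where "u = (5 * a ^ 2 - 3 * a - 4) / 22" and "v = (5 * b ^ 2 - 3 * b - 4) / 22"
    and "w = (5 * c ^ 2 - 3 * c - 4) / 22"
  have u: "22 * u = 5 * a ^ 2 - 3 * a - 4" and v: "22 * v = 5 * b ^ 2 - 3 * b - 4"
    and w: "22 * w = 5 * c ^ 2 - 3 * c - 4"
    by (simp_all add: u_def v_def w_def)
  \<comment> \<open>Powers of a Binet coefficient, reduced modulo the cubic.\<close>
  have sq: "44 * y ^ 2 = - (x ^ 2) + 4 * x + 1" and cube: "484 * y ^ 3 = 5 * x ^ 2 - 3 * x + 7"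
    if "22 * y = 5 * x ^ 2 - 3 * x - 4" "x ^ 3 = x ^ 2 + x + 1" for x y :: complex
  proof -
    show sq: "44 * y ^ 2 = - (x ^ 2) + 4 * x + 1"
      using that by algebra
    then show "484 * y ^ 3 = 5 * x ^ 2 - 3 * x + 7"
      using that by algebra
  qed
  note squ = sq[OF u a] and sqv = sq[OF v b] and sqw = sq[OF w c]
  note cubu = cube[OF u a] and cubv = cube[OF v b] and cubw = cube[OF w c]

  have s: "u + v + w = 0"
    using u v w e1 p2 by algebra
  have "11 * (u ^ 2 + v ^ 2 + w ^ 2) = 1"
    using squ sqv sqw e1 p2 by algebra
  then have q: "22 * (u * v + v * w + w * u) = - 1"
    using s by algebra
  \<comment> \<open>As \<open>u + v = - w\<close>, \<open>u * v\<close> is \<open>w ^ 2\<close> plus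
    the symmetric sum \<open>-1/22\<close>, hence a polynomial in \<open>c\<close> alone.\<close>
  have uv: "44 * (u * v) = - (c ^ 2) + 4 * c - 1" and vw: "44 * (v * w) = - (a ^ 2) + 4 * a - 1"
    and wu: "44 * (w * u) = - (b ^ 2) + 4 * b - 1"
    using s q squ sqv sqw by algebra+
  have uvw: "44 * (u * v * w) = 1"
    using uv w c by algebra

  have T1: "tribonacci n = u * a ^ n + v * b ^ n + w * c ^ n" for n
    unfolding tribonacci_def
  proof (rule gen_tribonacci_binet[OF a b c])
    show "1 = u * a + v * b + w * c"
      using u v w e1 p2 p3 by algebra
    show "1 = u * a ^ 2 + v * b ^ 2 + w * c ^ 2"
      using u v w p2 p3 p4 by algebra
  qed (simp add: s)
  \<comment> \<open>The three auxiliary sequences have Binet coefficients proportional to squares,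
    cubes and pairwise products of \<open>u, v, w\<close>; the factors 22 and 44 make the seeds
    integers.\<close>
  have T2: "gen_tribonacci 2 3 10 n = (22 * u ^ 2) * a ^ n + (22 * v ^ 2) * b ^ n + (22 * w ^ 2) * c ^ n"
    for n
  proof (rule gen_tribonacci_binet[OF a b c])
    show "2 = 22 * u ^ 2 + 22 * v ^ 2 + 22 * w ^ 2"
      using squ sqv sqw e1 p2 by algebra
    show "3 = 22 * u ^ 2 * a + 22 * v ^ 2 * b + 22 * w ^ 2 * c"
      using squ sqv sqw e1 p2 p3 by algebra
    show "10 = 22 * u ^ 2 * a ^ 2 + 22 * v ^ 2 * b ^ 2 + 22 * w ^ 2 * c ^ 2"
      using squ sqv sqw p2 p3 p4 by algebra
  qed
  have T3: "gen_tribonacci 3 3 5 n = (44 * u ^ 3) * a ^ n + (44 * v ^ 3) * b ^ n + (44 * w ^ 3) * c ^ n"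
    for n
  proof (rule gen_tribonacci_binet[OF a b c])
    show "3 = 44 * u ^ 3 + 44 * v ^ 3 + 44 * w ^ 3"
      using cubu cubv cubw e1 p2 by algebra
    show "3 = 44 * u ^ 3 * a + 44 * v ^ 3 * b + 44 * w ^ 3 * c"
      using cubu cubv cubw e1 p2 p3 by algebra
    show "5 = 44 * u ^ 3 * a ^ 2 + 44 * v ^ 3 * b ^ 2 + 44 * w ^ 3 * c ^ 2"
      using cubu cubv cubw p2 p3 p4 by algebra
  qed
  have T4: "gen_tribonacci (- 1) 2 7 n
      = (22 * (v * w)) * a ^ n + (22 * (w * u)) * b ^ n + (22 * (u * v)) * c ^ n" for n
  proof (rule gen_tribonacci_binet[OF a b c])
    show "- 1 = 22 * (v * w) + 22 * (w * u) + 22 * (u * v)"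
      using q by (simp add: algebra_simps)
    show "2 = 22 * (v * w) * a + 22 * (w * u) * b + 22 * (u * v) * c"
      using uv vw wu e1 p2 p3 by algebra
    show "7 = 22 * (v * w) * a ^ 2 + 22 * (w * u) * b ^ 2 + 22 * (u * v) * c ^ 2"
      using uv vw wu p2 p3 p4 by algebra
  qed

  define X Y Z where "X = fps_const u * fps_exp a" and "Y = fps_const v * fps_exp b"
    and "Z = fps_const w * fps_exp c"
  have F: "egf tribonacci = X + Y + Z"
    by (rule fps_ext) (simp add: X_def Y_def Z_def T1 add_divide_distrib)
  \<comment> \<open>The scaled exponent is the source of \<open>2 ^ n\<close> and
    \<open>3 ^ n\<close>.\<close>
  have pow: "(fps_const y * fps_exp x) ^ k = fps_const (y ^ k) * fps_exp (of_nat k * x)"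
    for x y :: complex and k
    by (simp add: power_mult_distrib fps_exp_power_mult fps_const_power)
  have P3: "egf (\<lambda>n. 3 ^ n * gen_tribonacci 3 3 5 n) = fps_const 44 * (X ^ 3 + Y ^ 3 + Z ^ 3)"
    unfolding X_def Y_def Z_def pow
    by (rule fps_ext) (simp add: T3 add_divide_distrib power_mult_distrib algebra_simps)
  have P2: "egf (\<lambda>n. 2 ^ n * gen_tribonacci 2 3 10 n) = fps_const 22 * (X ^ 2 + Y ^ 2 + Z ^ 2)"
    unfolding X_def Y_def Z_def pow
    by (rule fps_ext) (simp add: T2 add_divide_distrib power_mult_distrib algebra_simps)
  \<comment> \<open>In the last sum of the theorem only the multinomial depends on
    \<open>k3\<close>, so the third factor is the constant sequence 1.\<close>
  have E: "egf (\<lambda>_. 1) = fps_exp (1 :: complex)"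
    by (rule fps_ext) simp
  have E3: "fps_exp 1 = fps_const 44 * (X * Y * Z)"
  proof -
    have "fps_const 44 * (X * Y * Z) = fps_const (44 * (u * v * w)) * fps_exp (a + b + c)"
      by (simp add: X_def Y_def Z_def fps_exp_add_mult flip: fps_const_mult)
    then show ?thesis
      by (simp add: uvw e1)
  qed
  have E2: "egf (\<lambda>n. (- 1) ^ n * gen_tribonacci (- 1) 2 7 n) * fps_exp 1
      = fps_const 22 * (X * Y + Y * Z + Z * X)"
  proof -
    have "egf (\<lambda>n. (- 1) ^ n * gen_tribonacci (- 1) 2 7 n)
        = fps_const 22 * (fps_const (v * w) * fps_exp (- a) + fps_const (w * u) * fps_exp (- b)
            + fps_const (u * v) * fps_exp (- c))"
      by (rule fps_ext)
        (simp add: T4 add_divide_distrib algebra_simps power_minus[of a] power_minus[of b]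
          power_minus[of c])
    moreover have "fps_exp (- a) * fps_exp 1 = fps_exp b * fps_exp c"
      "fps_exp (- b) * fps_exp 1 = fps_exp c * fps_exp a"
      "fps_exp (- c) * fps_exp 1 = fps_exp a * fps_exp b"
      unfolding fps_exp_add_mult[symmetric] e1[symmetric] by simp_all
    then have "fps_const (v * w) * fps_exp (- a) * fps_exp 1 = Y * Z"
      "fps_const (w * u) * fps_exp (- b) * fps_exp 1 = Z * X"
      "fps_const (u * v) * fps_exp (- c) * fps_exp 1 = X * Y"
      by (simp_all only: mult.assoc)
        (simp_all only: X_def Y_def Z_def fps_const_mult[symmetric] mult_ac)
    ultimately show ?thesis
      by (simp only: distrib_right mult.assoc[of "fps_const 22"]) (simp only: add_ac)
  qed

  have "(\<Sum>(k1, k2, k3) \<in> {(k1, k2, k3). k1 + k2 + k3 = n \<and> k1 \<ge> 1 \<and> k2 \<ge> 1 \<and> k3 \<ge> 1}.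
            multinomial3 n k1 k2 k3 * tribonacci k1 * tribonacci k2 * tribonacci k3)
      = (\<Sum>(k1, k2, k3) \<in> {(k1, k2, k3). k1 + k2 + k3 = n}.
            multinomial3 n k1 k2 k3 * tribonacci k1 * tribonacci k2 * (tribonacci k3 :: complex))"
  \<comment> \<open>Triples with a zero index contribute nothing because
    \<open>tribonacci 0 = 0\<close>.\<close>
  proof (rule sum.mono_neutral_left[OF finite_triples_sum])
    have "k \<ge> 1 \<or> tribonacci k = (0 :: complex)" for k
      by (cases k) (simp_all add: tribonacci_def)
    then show "\<forall>i\<in>{(k1, k2, k3). k1 + k2 + k3 = n}
        - {(k1, k2, k3). k1 + k2 + k3 = n \<and> k1 \<ge> 1 \<and> k2 \<ge> 1 \<and> k3 \<ge> 1}.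
        (case i of (k1, k2, k3) \<Rightarrow>
          multinomial3 n k1 k2 k3 * tribonacci k1 * tribonacci k2 * tribonacci k3) = (0 :: complex)"
      by fastforce
  qed auto
  also have "\<dots> = fact n * ((X + Y + Z) ^ 3) $ n"
    by (simp only: sum_multinomial3_eq_egf F power3_eq_cube)
  \<comment> \<open>Comparing \<open>X ^ 3\<close>, \<open>X ^ 2 * Y\<close> and
    \<open>X * Y * Z\<close> gives \<open>A + C = 1\<close>, \<open>C + D = 3\<close>,
    \<open>B + 3 * D = 6\<close>, a family with free parameter \<open>D\<close>.\<close>
  also have "(X + Y + Z) ^ 3 = fps_const A * (X ^ 3 + Y ^ 3 + Z ^ 3) + fps_const B * (X * Y * Z)
      + fps_const C * ((X ^ 2 + Y ^ 2 + Z ^ 2) * (X + Y + Z))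
      + fps_const D * ((X * Y + Y * Z + Z * X) * (X + Y + Z))"
  proof -
    have "fps_const A = fps_const D - 2" "fps_const B = 6 - 3 * fps_const D"
      "fps_const C = 3 - fps_const D"
      by (simp_all add: assms numeral_fps_const)
    then show ?thesis
      by algebra
  qed
  also have "fact n * \<dots> $ n = A / 44 * (fact n * (fps_const 44 * (X ^ 3 + Y ^ 3 + Z ^ 3)) $ n)
      + B / 44 * (fact n * (fps_const 44 * (X * Y * Z)) $ n)
      + C / 22 * (fact n * (fps_const 22 * (X ^ 2 + Y ^ 2 + Z ^ 2) * (X + Y + Z)) $ n)
      + D / 22 * (fact n * (fps_const 22 * (X * Y + Y * Z + Z * X) * (X + Y + Z)) $ n)"
    by (simp only: fps_add_nth fps_mult_left_const_nth mult.assoc) (simp add: algebra_simps)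
  also have "fact n * (fps_const 44 * (X ^ 3 + Y ^ 3 + Z ^ 3)) $ n = 3 ^ n * gen_tribonacci 3 3 5 n"
    by (simp flip: P3)
  also have "fact n * (fps_const 44 * (X * Y * Z)) $ n = 1"
    by (simp flip: E3)
  also have "fact n * (fps_const 22 * (X ^ 2 + Y ^ 2 + Z ^ 2) * (X + Y + Z)) $ n
      = (\<Sum>k = 0..n. of_nat (n choose k) * 2 ^ (n - k) * gen_tribonacci 2 3 10 (n - k) * tribonacci k)"
    unfolding P2[symmetric] F[symmetric] sum_binomial_eq_egf[symmetric] by (simp add: mult.assoc)
  also have "fps_const 22 * (X * Y + Y * Z + Z * X) * (X + Y + Z)
      = egf (\<lambda>n. (- 1) ^ n * gen_tribonacci (- 1) 2 7 n) * egf tribonacci * egf (\<lambda>_. 1)"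
    unfolding E2[symmetric] F E by (simp only: mult_ac)
  also have "fact n * \<dots> $ n = (\<Sum>(k1, k2, k3) \<in> {(k1, k2, k3). k1 + k2 + k3 = n}.
      multinomial3 n k1 k2 k3 * (- 1) ^ k1 * gen_tribonacci (- 1) 2 7 k1 * tribonacci k2)"
    unfolding sum_multinomial3_eq_egf[symmetric] by (simp add: mult.assoc)
  finally show ?thesis
    by simp
qed

end
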